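(* Let $q$ be a complex number with $|q|<1$. For any complex number $c$ such that $|c|<1$, we have $$\sigma(q)=(-c)_{\infty}\sum_{n=0}^{\infty}\frac{q^{n(n+1)/2}}{(-q)_n(1-cq^n)}-2\sum_{m,n=0}^{\infty}\frac{(-q)_m}{(q)_m(q)_n}\,\frac{(-1)^nq^{n(n+1)/2}c^{m+n+1}}{1-q^{n+m+1}}.$$
   Context: For complex $A$ and $|q|<1$: $(A)_0=1$, $(A)_n=(A;q)_n=(1-A)(1-Aq)\cdots(1-Aq^{n-1})$ for positive integers $n$, and $(A)_\infty=(A;q)_\infty=\lim_{n\to\infty}(A;q)_n$. In particular $(-c)_\infty=(-c;q)_\infty$ and $(-q)_n=(-q;q)_n$. Ramanujan's function $\sigma(q)$ is defined by $$\sigma(q)=\sum_{n=0}^{\infty}\frac{q^{n(n+1)/2}}{(-q)_n}.$$ *)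

theory Defs
  imports "HOL-Analysis.Analysis"
begin

definition qpoch :: "complex \<Rightarrow> complex \<Rightarrow> nat \<Rightarrow> complex" where
  "qpoch A q n = (\<Prod>k<n. 1 - A * q ^ k)"

definition qpoch_inf :: "complex \<Rightarrow> complex \<Rightarrow> complex" where
  "qpoch_inf A q = lim (\<lambda>n. qpoch A q n)"

definition ramanujan_sigma :: "complex \<Rightarrow> complex" where
  "ramanujan_sigma q = (\<Sum>n. q ^ (n * (n + 1) div 2) / qpoch (- q) q n)"

end

theory Submission
  imports Defs
begin

text \<open>
  The right-hand side, regarded as a function \<open>H(c)\<close> on the open unit disc, is invariant under
  \<open>c \<mapsto> c q\<close>. Since \<open>c q\<^sup>n \<rightarrow> 0\<close> and \<open>H\<close> is continuous at \<open>0\<close>, it follows that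
  \<open>H(c) = H(0)\<close>, and \<open>H(0) = \<sigma>(q)\<close> can be read off from the series.

  Write \<open>H(c) = (-c)\<^sub>\<infinity> F(c) - 2 D(c)\<close>, where \<open>F\<close> is the single series and \<open>D\<close> the double series.

  \<^item> Replacing \<open>c\<close> by \<open>c q\<close> in \<open>D\<close> multiplies the term of index \<open>(m, n)\<close> by \<open>q\<^bsup>m+n+1\<^esup>\<close>, so in
    \<open>D(c) - D(c q)\<close> the denominator \<open>1 - q\<^bsup>m+n+1\<^esup>\<close> cancels and the double sum factors as
    \<open>c P(c) E(c)\<close>, with \<open>P(c) = \<Sum> (-q)\<^sub>m c\<^sup>m / (q)\<^sub>m\<close> an instance of the q-binomial series and
    \<open>E(c) = \<Sum> (-1)\<^sup>n q\<^bsup>n(n+1)/2\<^esup> c\<^sup>n / (q)\<^sub>n\<close> an Euler series.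

  \<^item> Both \<open>P\<close> and \<open>E\<close> have coefficients with a first-order q-recurrence, hence satisfy
    q-difference equations (\<open>q_series_functional_eq\<close>). Together these say that
    \<open>R(c) = (1 - c) P(c) E(c)\<close> satisfies \<open>R(c) = (1 + c q) R(c q)\<close> with \<open>R(0) = 1\<close>. Iterating, the
    finite products \<open>(-c q)\<^sub>n\<close> converge to \<open>R(c)\<close>; that is, \<open>P(c) E(c) = (-c q)\<^sub>\<infinity> / (1 - c)\<close>. This
    also gives convergence of the infinite product and its continuity at \<open>0\<close>.

  \<^item> A telescoping series shows \<open>(1 + c) F(c) - F(c q) = 2 c / (1 - c)\<close>
    (\<open>partial_fraction_series_functional_eq\<close>).

  Because \<open>(-c)\<^sub>\<infinity> = (1 + c) (-c q)\<^sub>\<infinity>\<close>, the last two points give that \<open>(-c)\<^sub>\<infinity> F(c)\<close> drops by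
  \<open>2 c (-c q)\<^sub>\<infinity> / (1 - c)\<close> under \<open>c \<mapsto> c q\<close>. By the first two, \<open>2 D(c)\<close> drops by the same amount,
  so \<open>H\<close> is invariant.
\<close>

section \<open>Continuity, summability and products of series\<close>

lemma isCont_0_if_linear_bound:
  fixes f :: "complex \<Rightarrow> complex"
  assumes "r > 0" "\<And>x. norm x < r \<Longrightarrow> norm (f x - f 0) \<le> norm x * M"
  shows "isCont f 0"
proof -
  have "((\<lambda>x. f x - f 0) \<longlongrightarrow> 0) (at 0)"
  proof (rule Lim_null_comparison)
    show "\<forall>\<^sub>F x in at 0. norm (f x - f 0) \<le> norm x * M"
      using assms unfolding eventually_at by (auto simp: dist_norm)
    show "((\<lambda>x::complex. norm x * M) \<longlongrightarrow> 0) (at 0)"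
      by (rule tendsto_eq_intros refl | simp)+
  qed
  thus ?thesis
    unfolding isCont_def using LIM_zero_cancel by blast
qed

lemma summable_norm_if_ratio_tendsto:
  fixes u r :: "nat \<Rightarrow> complex"
  assumes rec: "\<And>n. u (Suc n) = r n * u n"
    and lim: "r \<longlonglongrightarrow> \<rho>" and less: "norm \<rho> < 1"
  shows "summable (\<lambda>n. norm (u n))"
proof -
  define c where "c = (1 + norm \<rho>) / 2"
  have c: "norm \<rho> < c" "c < 1" using less by (auto simp: c_def)
  have "\<forall>\<^sub>F n in sequentially. norm (r n) < c"
    using order_tendstoD(2)[OF tendsto_norm[OF lim] c(1)] .
  then obtain N where N: "\<And>n. n \<ge> N \<Longrightarrow> norm (r n) < c"
    by (auto simp: eventually_sequentially)
  show ?thesis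
  proof (rule summable_ratio_test[OF c(2)])
    fix n assume "n \<ge> N"
    hence "norm (r n) * norm (u n) \<le> c * norm (u n)"
      using N by (intro mult_right_mono) (auto simp: less_imp_le)
    thus "norm (norm (u (Suc n))) \<le> c * norm (norm (u n))"
      by (simp add: rec norm_mult)
  qed
qed

text \<open>
  Absolute convergence makes the unordered sum over all index pairs an iterated sum, which factors.
\<close>
lemma
  fixes f g :: "nat \<Rightarrow> complex"
  assumes f: "summable (\<lambda>n. norm (f n))" and g: "summable (\<lambda>n. norm (g n))"
  shows summable_on_norm_product: "(\<lambda>(m, n). norm (f m * g n)) summable_on UNIV"
    and infsum_product: "(\<Sum>\<^sub>\<infinity>(m, n)\<in>UNIV. f m * g n) = (\<Sum>m. f m) * (\<Sum>n. g n)"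
proof -
  have fs: "(\<lambda>n. norm (f n)) summable_on UNIV"
    and gs: "(\<lambda>n. norm (g n)) summable_on UNIV"
    using f g by (auto intro: norm_summable_imp_summable_on)
  have "(\<lambda>x. norm (case x of (m, n) \<Rightarrow> f m * g n)) summable_on (SIGMA m:UNIV. UNIV)"
  proof (subst Infinite_Sum.abs_summable_on_Sigma_iff, intro conjI ballI)
    fix m :: nat
    show "(\<lambda>n. norm (case (m, n) of (m, n) \<Rightarrow> f m * g n)) summable_on UNIV"
      using gs by (auto simp: norm_mult intro: summable_on_cmult_right)
  next
    have "(\<lambda>m. norm (f m) * (\<Sum>\<^sub>\<infinity>n. norm (g n))) summable_on UNIV"
      using fs by (rule summable_on_cmult_left)
    thus "(\<lambda>m. norm (\<Sum>\<^sub>\<infinity>n. norm (case (m, n) of (m, n) \<Rightarrow> f m * g n))) summable_on UNIV"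
      by (simp add: norm_mult infsum_cmult_right' infsum_nonneg)
  qed
  thus *: "(\<lambda>(m, n). norm (f m * g n)) summable_on UNIV"
    by (simp add: case_prod_unfold)
  have eqs: "(\<Sum>\<^sub>\<infinity>n. f n) = suminf f" "(\<Sum>\<^sub>\<infinity>n. g n) = suminf g"
    using infsumI norm_summable_imp_has_sum summable_sums summable_norm_cancel f g by blast+
  have "(\<lambda>(m, n). f m * g n) summable_on (UNIV \<times> UNIV)"
    by (rule abs_summable_summable) (use * in \<open>simp add: case_prod_unfold\<close>)
  from infsum_Sigma'_banach[OF this]
  show "(\<Sum>\<^sub>\<infinity>(m, n)\<in>UNIV. f m * g n) = (\<Sum>m. f m) * (\<Sum>n. g n)"
    by (simp add: infsum_cmult_right' infsum_cmult_left' eqs)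
qed

section \<open>Finite q-products and q-difference equations\<close>

lemma power_Suc_ne:
  fixes q :: complex
  assumes "norm q < 1"
  shows "1 - q ^ Suc n \<noteq> 0" "1 + q ^ Suc n \<noteq> 0"
proof -
  have "norm (q ^ Suc n) \<le> norm q ^ 1"
    unfolding norm_power using assms by (intro power_decreasing) auto
  hence "norm (q ^ Suc n) < 1" using assms by simp
  hence "q ^ Suc n \<noteq> 1" "q ^ Suc n \<noteq> - 1"
    by (metis norm_one less_irrefl, metis norm_minus_cancel norm_one less_irrefl)
  thus "1 - q ^ Suc n \<noteq> 0" "1 + q ^ Suc n \<noteq> 0"
    by (auto simp only: add_eq_0_iff right_minus_eq minus_minus)
qed

lemma power_triangle_Suc:
  fixes q :: complex
  shows "q ^ (Suc n * (Suc n + 1) div 2) = q ^ Suc n * q ^ (n * (n + 1) div 2)"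
proof -
  have "Suc n * (Suc n + 1) = n * (n + 1) + 2 * Suc n" by simp
  hence "Suc n * (Suc n + 1) div 2 = Suc n + n * (n + 1) div 2" by (simp only: div_mult_self2)
  thus ?thesis by (simp only: power_add)
qed

lemma qpoch_0 [simp]: "qpoch a q 0 = 1"
  by (simp add: qpoch_def)

lemma qpoch_Suc: "qpoch a q (Suc n) = qpoch a q n * (1 - a * q ^ n)"
  by (simp add: qpoch_def)

lemma qpoch_Suc_left: "qpoch a q (Suc n) = (1 - a) * qpoch (a * q) q n"
  by (simp only: qpoch_def prod.lessThan_Suc_shift) (simp add: mult_ac)

lemma tendsto_orbit:
  fixes f :: "complex \<Rightarrow> complex"
  assumes q: "norm q < 1" and cont: "isCont f 0"
  shows "(\<lambda>n. f (z * q ^ n)) \<longlonglongrightarrow> f 0"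
proof (rule isCont_tendsto_compose[OF cont])
  show "(\<lambda>n. z * q ^ n) \<longlonglongrightarrow> 0"
    using tendsto_mult_right_zero[OF LIMSEQ_power_zero[OF q]] .
qed

text \<open>
  Iterating the equation gives \<open>f z = (a z)\<^sub>n f (z q\<^sup>n)\<close>, and the second factor tends to \<open>f 0\<close>. So the
  infinite product is shown to converge and is evaluated by the same argument.
\<close>
lemma qpoch_tendsto_if_functional_eq:
  fixes f :: "complex \<Rightarrow> complex"
  assumes q: "norm q < 1" and cont: "isCont f 0" and f0: "f 0 \<noteq> 0"
    and feq: "\<And>z. norm z < 1 \<Longrightarrow> f z = (1 - a * z) * f (z * q)"
    and z: "norm z < 1"
  shows "(\<lambda>n. qpoch (a * z) q n) \<longlonglongrightarrow> f z / f 0"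
proof -
  have iter: "f z = qpoch (a * z) q n * f (z * q ^ n)" for n
  proof (induction n)
    case (Suc n)
    have "norm (z * q ^ n) \<le> norm z"
      using q by (simp add: norm_mult norm_power mult_left_le power_le_one)
    thus ?case using feq[of "z * q ^ n"] z Suc by (simp add: qpoch_Suc mult_ac)
  qed simp
  have lim: "(\<lambda>n. f (z * q ^ n)) \<longlonglongrightarrow> f 0"
    by (rule tendsto_orbit[OF q cont])
  have "(\<lambda>n. f z / f (z * q ^ n)) \<longlonglongrightarrow> f z / f 0"
    by (intro tendsto_intros lim f0)
  moreover have "\<forall>\<^sub>F n in sequentially. f z / f (z * q ^ n) = qpoch (a * z) q n"
    using tendsto_imp_eventually_ne[OF lim f0]
  proof eventually_elim
    case (elim n)
    thus ?case using iter[of n] by (simp add: field_simps)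
  qed
  ultimately show ?thesis by (rule Lim_transform_eventually)
qed

text \<open>
  A common setting for the q-binomial series and the Euler series: both have coefficients \<open>u\<close> obeying
  the recurrence below. The ratio of consecutive terms of \<open>\<Sum> u\<^sub>n z\<^sup>n\<close> tends to \<open>\<alpha> z\<close>, so the bound on
  \<open>\<alpha>\<close> gives absolute convergence on the unit disc.
\<close>
context
  fixes q \<alpha> \<beta> :: complex and u :: "nat \<Rightarrow> complex"
  assumes q: "norm q < 1"
    and rec: "\<And>n. (1 - q ^ Suc n) * u (Suc n) = (\<alpha> + \<beta> * q ^ n) * u n"
    and \<alpha>: "norm \<alpha> \<le> 1"
begin

lemma summable_norm_q_series:
  assumes "norm z < 1"
  shows "summable (\<lambda>n. norm (u n * z ^ n))"
proof (rule summable_norm_if_ratio_tendsto)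
  define r where "r n = (\<alpha> + \<beta> * q ^ n) / (1 - q ^ Suc n) * z" for n
  show "u (Suc n) * z ^ Suc n = r n * (u n * z ^ n)" for n
  proof -
    have "u (Suc n) = (\<alpha> + \<beta> * q ^ n) * u n / (1 - q ^ Suc n)"
      using rec[of n] power_Suc_ne(1)[OF q, of n] by (metis nonzero_mult_div_cancel_left)
    thus ?thesis by (simp add: r_def)
  qed
  have "r \<longlonglongrightarrow> (\<alpha> + \<beta> * 0) / (1 - 0) * z"
    unfolding r_def
    by (intro tendsto_intros LIMSEQ_power_zero[OF q] LIMSEQ_Suc[OF LIMSEQ_power_zero[OF q]]) auto
  thus "r \<longlonglongrightarrow> \<alpha> * z" by simp
  show "norm (\<alpha> * z) < 1"
    using mult_right_mono[OF \<alpha>, of "norm z"] assms by (simp add: norm_mult)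
qed

lemma isCont_0_q_series: "isCont (\<lambda>z. \<Sum>n. u n * z ^ n) 0"
proof (rule isCont_powser)
  show "summable (\<lambda>n. u n * (1 / 2) ^ n)"
    by (rule summable_norm_cancel[OF summable_norm_q_series]) simp
qed simp

text \<open>
  Passing from \<open>z\<close> to \<open>z q\<close> multiplies the coefficient of \<open>z\<^sup>n\<close> by \<open>q\<^sup>n\<close>, so the difference has
  coefficients \<open>(1 - q\<^sup>n) u\<^sub>n\<close>. Its constant term vanishes, and the recurrence expresses the others
  through their predecessors.
\<close>
lemma q_series_functional_eq:
  assumes z: "norm z < 1"
  shows "(\<Sum>n. u n * z ^ n) - (\<Sum>n. u n * (z * q) ^ n) =
    z * (\<alpha> * (\<Sum>n. u n * z ^ n) + \<beta> * (\<Sum>n. u n * (z * q) ^ n))"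
proof -
  have zq: "norm (z * q) < 1"
    using mult_strict_mono[of "norm z" 1 "norm q" 1] z q by (simp add: norm_mult)
  have s: "summable (\<lambda>n. u n * z ^ n)" "summable (\<lambda>n. u n * (z * q) ^ n)"
    using summable_norm_cancel[OF summable_norm_q_series] z zq by auto
  define d where "d n = u n * z ^ n - u n * (z * q) ^ n" for n
  have d: "summable d" unfolding d_def by (intro summable_diff s)
  have d_Suc: "d (Suc n) = z * (\<alpha> * (u n * z ^ n) + \<beta> * (u n * (z * q) ^ n))" for n
  proof -
    have "d (Suc n) = ((1 - q ^ Suc n) * u (Suc n)) * z ^ Suc n"
      by (simp add: d_def power_mult_distrib algebra_simps)
    also have "\<dots> = z * (\<alpha> * (u n * z ^ n) + \<beta> * (u n * (z * q) ^ n))"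
      unfolding rec by (simp add: power_mult_distrib algebra_simps)
    finally show ?thesis .
  qed
  have "(\<Sum>n. u n * z ^ n) - (\<Sum>n. u n * (z * q) ^ n) = suminf d"
    unfolding d_def by (rule suminf_diff[OF s])
  also have "\<dots> = (\<Sum>n. d (Suc n))"
    using suminf_split_head[OF d] by (simp add: d_def)
  also have "\<dots> = z * (\<alpha> * (\<Sum>n. u n * z ^ n) + \<beta> * (\<Sum>n. u n * (z * q) ^ n))"
    unfolding d_Suc using s
    by (simp add: suminf_mult suminf_add summable_mult summable_add flip: suminf_mult)
  finally show ?thesis .
qed

end

section \<open>The infinite product as a product of two power series\<close>

context
  fixes q :: complex
  assumes q: "norm q < 1"
begin

definition sigma_term :: "nat \<Rightarrow> complex" where
  "sigma_term n = q ^ (n * (n + 1) div 2) / qpoch (- q) q n"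

definition binomial_coeff :: "nat \<Rightarrow> complex" where
  "binomial_coeff m = qpoch (- q) q m / qpoch q q m"

definition euler_coeff :: "nat \<Rightarrow> complex" where
  "euler_coeff n = (- 1) ^ n * q ^ (n * (n + 1) div 2) / qpoch q q n"

lemma sigma_term_0: "sigma_term 0 = 1"
  by (simp add: sigma_term_def)

text \<open>
  Stated without division by a power of \<open>q\<close>, the recurrence makes the telescoping below valid for
  \<open>q = 0\<close> as well.
\<close>
lemma sigma_term_Suc: "(1 + q ^ Suc n) * sigma_term (Suc n) = q ^ Suc n * sigma_term n"
  using power_Suc_ne(2)[OF q, of n]
  unfolding sigma_term_def power_triangle_Suc by (simp add: qpoch_Suc)

lemma binomial_coeff_Suc:
  "(1 - q ^ Suc n) * binomial_coeff (Suc n) = (1 + q * q ^ n) * binomial_coeff n"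
  using power_Suc_ne(1)[OF q, of n] by (simp add: binomial_coeff_def qpoch_Suc)

text \<open>
  The right-hand side has the shape \<open>(\<alpha> + \<beta> q\<^sup>n) u\<^sub>n\<close> of the recurrence above, with \<open>\<alpha> = 0\<close>.
\<close>
lemma euler_coeff_Suc:
  "(1 - q ^ Suc n) * euler_coeff (Suc n) = (0 + - q * q ^ n) * euler_coeff n"
  using power_Suc_ne(1)[OF q, of n]
  unfolding euler_coeff_def power_triangle_Suc by (simp add: qpoch_Suc)

definition binomial_series :: "complex \<Rightarrow> complex" where
  "binomial_series z = (\<Sum>m. binomial_coeff m * z ^ m)"

definition euler_series :: "complex \<Rightarrow> complex" where
  "euler_series z = (\<Sum>n. euler_coeff n * z ^ n)"

lemmas summable_binomial_series = summable_norm_q_series[OF q binomial_coeff_Suc, simplified]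
lemmas summable_euler_series = summable_norm_q_series[OF q euler_coeff_Suc, simplified]

lemma binomial_series_functional_eq:
  "norm z < 1 \<Longrightarrow> (1 - z) * binomial_series z = (1 + q * z) * binomial_series (z * q)"
  using q_series_functional_eq[OF q binomial_coeff_Suc, of z]
  unfolding binomial_series_def[symmetric] by (simp add: algebra_simps)

lemma euler_series_functional_eq:
  "norm z < 1 \<Longrightarrow> euler_series z = (1 - q * z) * euler_series (z * q)"
  using q_series_functional_eq[OF q euler_coeff_Suc, of z]
  unfolding euler_series_def[symmetric] by (simp add: algebra_simps)

text \<open>
  This is \<open>(-z q)\<^sub>\<infinity>\<close>: by the q-binomial theorem the binomial series equals \<open>(-z q)\<^sub>\<infinity> / (z)\<^sub>\<infinity>\<close>, and
  by Euler's identity the other series equals \<open>(z q)\<^sub>\<infinity>\<close>. The factor \<open>1 - z\<close> supplies the quotient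
  \<open>(z)\<^sub>\<infinity> / (z q)\<^sub>\<infinity>\<close>.
\<close>
definition product_series :: "complex \<Rightarrow> complex" where
  "product_series z = (1 - z) * binomial_series z * euler_series z"

lemma product_series_0: "product_series 0 = 1"
  unfolding product_series_def binomial_series_def euler_series_def powser_zero
  by (simp add: binomial_coeff_def euler_coeff_def)

text \<open>
  The factor \<open>1 - q z\<close> from the Euler series becomes the prefactor \<open>1 - z\<close> taken at \<open>z q\<close>.
\<close>
lemma product_series_functional_eq:
  assumes "norm z < 1"
  shows "product_series z = (1 - (- q) * z) * product_series (z * q)"
proof -
  have "product_series z = 
      ((1 + q * z) * binomial_series (z * q)) * ((1 - q * z) * euler_series (z * q))"
    unfolding product_series_def binomial_series_functional_eq[OF assms]
      euler_series_functional_eq[OF assms, symmetric] ..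
  thus ?thesis by (simp add: product_series_def mult_ac)
qed

lemma isCont_product_series: "isCont product_series 0"
proof -
  have "isCont binomial_series 0" "isCont euler_series 0"
    unfolding binomial_series_def[abs_def] euler_series_def[abs_def]
    by (rule isCont_0_q_series[OF q binomial_coeff_Suc] isCont_0_q_series[OF q euler_coeff_Suc]; simp)+
  thus ?thesis unfolding product_series_def[abs_def] by (intro continuous_intros)
qed

lemma qpoch_inf_eq_product_series:
  assumes "norm z < 1"
  shows "qpoch_inf (- z) q = (1 + z) * product_series z"
proof -
  have "(\<lambda>n. qpoch (- q * z) q n) \<longlonglongrightarrow> product_series z / product_series 0"
    using q isCont_product_series product_series_functional_eq assms
    by (intro qpoch_tendsto_if_functional_eq) (auto simp: product_series_0)
  hence "(\<lambda>n. (1 - (- z)) * qpoch (- z * q) q n) \<longlonglongrightarrow> (1 - (- z)) * product_series z"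
    by (intro tendsto_intros) (simp add: product_series_0 mult_ac)
  hence "(\<lambda>n. qpoch (- z) q (Suc n)) \<longlonglongrightarrow> (1 + z) * product_series z"
    by (simp add: qpoch_Suc_left)
  hence "(\<lambda>n. qpoch (- z) q n) \<longlonglongrightarrow> (1 + z) * product_series z"
    by (rule LIMSEQ_imp_Suc)
  thus ?thesis unfolding qpoch_inf_def by (rule limI)
qed

section \<open>The deformed sigma series\<close>

lemma summable_sigma_term: "summable (\<lambda>n. norm (sigma_term n))"
proof (rule summable_norm_if_ratio_tendsto)
  define r where "r n = q ^ Suc n / (1 + q ^ Suc n)" for n
  show "sigma_term (Suc n) = r n * sigma_term n" for n
    using sigma_term_Suc[of n] power_Suc_ne(2)[OF q, of n] by (simp add: r_def field_simps)
  have "r \<longlonglongrightarrow> 0 / (1 + 0)"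
    unfolding r_def
    by (intro tendsto_intros LIMSEQ_Suc[OF LIMSEQ_power_zero[OF q]]) auto
  thus "r \<longlonglongrightarrow> 0" by simp
qed simp

definition partial_fraction_series :: "complex \<Rightarrow> complex" where
  "partial_fraction_series z = (\<Sum>n. sigma_term n / (1 - z * q ^ n))"

lemma norm_orbit_le: "norm (z * q ^ n) \<le> norm z"
  using q by (simp add: norm_mult norm_power mult_left_le power_le_one)

lemma norm_orbit_denom: "1 - norm z \<le> norm (1 - z * q ^ n)"
  using norm_triangle_ineq2[of 1 "z * q ^ n"] norm_orbit_le[of z n] by simp

lemma summable_partial_fraction_series:
  assumes "norm z < 1"
  shows "summable (\<lambda>n. sigma_term n / (1 - z * q ^ n))"
proof (rule summable_comparison_test)
  have "norm (sigma_term n) / norm (1 - z * q ^ n) \<le> norm (sigma_term n) / (1 - norm z)" for n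
    using assms norm_orbit_denom[of z n] by (intro frac_le) auto
  thus "\<exists>N. \<forall>n\<ge>N. norm (sigma_term n / (1 - z * q ^ n)) \<le> norm (sigma_term n) / (1 - norm z)"
    by (auto simp: norm_divide)
  show "summable (\<lambda>n. norm (sigma_term n) / (1 - norm z))"
    by (intro summable_divide summable_sigma_term)
qed

text \<open>
  Matching the term of index \<open>n + 1\<close> at \<open>z\<close> with the term of index \<open>n\<close> at \<open>z q\<close> puts both over the
  denominator \<open>1 - z q\<^bsup>n+1\<^esup>\<close>. By the recurrence for the numerators \<open>a\<^sub>n\<close> of the series, the
  combination \<open>(1 + z) a\<^sub>n\<^sub>+\<^sub>1 - a\<^sub>n\<close> is divisible by this denominator with quotient
  \<open>a\<^sub>n\<^sub>+\<^sub>1 - a\<^sub>n\<close>, so the sum telescopes to \<open>-1\<close>. The term of index 0 at \<open>z\<close> is left over and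
  contributes \<open>(1 + z) / (1 - z)\<close>.
\<close>
lemma partial_fraction_series_functional_eq:
  assumes z: "norm z < 1"
  shows "(1 + z) * partial_fraction_series z - partial_fraction_series (z * q) = 2 * z / (1 - z)"
proof -
  have zq: "norm (z * q) < 1" using norm_orbit_le[of z 1] z by simp
  have ne: "1 - z * q ^ n \<noteq> 0" for n
    using norm_orbit_denom[of z n] z by auto
  define b where "b n = sigma_term n / (1 - z * q ^ n)" for n
  have b: "summable b" unfolding b_def using summable_partial_fraction_series[OF z] .
  have c: "summable (\<lambda>n. sigma_term n / (1 - z * q ^ Suc n))"
    using summable_partial_fraction_series[OF zq] by (simp add: mult_ac)
  have step: "(1 + z) * b (Suc n) - sigma_term n / (1 - z * q ^ Suc n) =
      sigma_term (Suc n) - sigma_term n" for n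
  proof -
    have "(1 + z) * sigma_term (Suc n) - sigma_term n =
        (sigma_term (Suc n) - sigma_term n) * (1 - z * q ^ Suc n)"
    proof -
      have "(1 + z) * sigma_term (Suc n) - sigma_term n -
          (sigma_term (Suc n) - sigma_term n) * (1 - z * q ^ Suc n) =
          z * ((1 + q ^ Suc n) * sigma_term (Suc n) - q ^ Suc n * sigma_term n)"
        by (simp add: algebra_simps)
      thus ?thesis unfolding sigma_term_Suc by simp
    qed
    moreover have "(1 + z) * b (Suc n) - sigma_term n / (1 - z * q ^ Suc n) =
        ((1 + z) * sigma_term (Suc n) - sigma_term n) / (1 - z * q ^ Suc n)"
      unfolding b_def diff_divide_distrib times_divide_eq_right ..
    ultimately show ?thesis
      using ne[of "Suc n"] 
      by (simp only: nonzero_mult_div_cancel_right if_True not_False_eq_True simp_thms)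
  qed
  have tel: "(\<lambda>n. sigma_term (Suc n) - sigma_term n) sums (0 - sigma_term 0)"
    using summable_LIMSEQ_zero[OF summable_norm_cancel[OF summable_sigma_term]]
    by (rule telescope_sums)
  have "(1 + z) * (\<Sum>n. b (Suc n)) - partial_fraction_series (z * q) =
      (\<Sum>n. (1 + z) * b (Suc n) - sigma_term n / (1 - z * q ^ Suc n))"
  proof (subst suminf_diff[symmetric])
    show "summable (\<lambda>n. (1 + z) * b (Suc n))" using b by (simp add: summable_Suc_iff summable_mult)
    show "(1 + z) * (\<Sum>n. b (Suc n)) - partial_fraction_series (z * q) =
        (\<Sum>n. (1 + z) * b (Suc n)) - (\<Sum>n. sigma_term n / (1 - z * q ^ Suc n))"
      using b by (simp add: partial_fraction_series_def suminf_mult summable_Suc_iff mult_ac)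
  qed (rule c)
  also have "\<dots> = - 1" unfolding step using sums_unique[OF tel] by (simp add: sigma_term_0)
  finally have "(1 + z) * (\<Sum>n. b (Suc n)) - partial_fraction_series (z * q) = - 1" .
  moreover have "partial_fraction_series z = 1 / (1 - z) + (\<Sum>n. b (Suc n))"
    unfolding partial_fraction_series_def b_def[symmetric] using suminf_split_head[OF b]
    by (simp add: sigma_term_0 b_def[of 0])
  ultimately have "(1 + z) * partial_fraction_series z - partial_fraction_series (z * q) =
      (1 + z) / (1 - z) - 1"
    by (simp add: algebra_simps add_divide_distrib)
  also have "\<dots> = 2 * z / (1 - z)" using ne[of 0] by (simp add: field_simps)
  finally show ?thesis .
qed

lemma partial_fraction_series_0: "partial_fraction_series 0 = ramanujan_sigma q"
  by (simp add: partial_fraction_series_def ramanujan_sigma_def sigma_term_def)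

lemma isCont_partial_fraction_series: "isCont partial_fraction_series 0"
proof (rule isCont_0_if_linear_bound)
  fix x :: complex assume x: "norm x < 1 / 2"
  define t where "t n = norm x * (2 * norm (sigma_term n))" for n
  have t: "summable t" unfolding t_def by (intro summable_mult summable_sigma_term)
  have at_0: "partial_fraction_series 0 = (\<Sum>n. sigma_term n)"
    by (simp add: partial_fraction_series_def)
  have "partial_fraction_series x - partial_fraction_series 0 =
      (\<Sum>n. sigma_term n / (1 - x * q ^ n) - sigma_term n)"
    unfolding at_0 unfolding partial_fraction_series_def using x
    by (intro suminf_diff summable_partial_fraction_series summable_norm_cancel[OF summable_sigma_term]) auto
  also have "norm \<dots> \<le> suminf t"
  proof (rule norm_suminf_le[OF _ t])
    fix n
    have d: "1 / 2 \<le> norm (1 - x * q ^ n)"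
      using norm_orbit_denom[of x n] x by linarith
    hence "1 - x * q ^ n \<noteq> 0" by auto
    hence "sigma_term n / (1 - x * q ^ n) - sigma_term n = sigma_term n * (x * q ^ n) / (1 - x * q ^ n)"
      by (simp add: divide_simps) (simp add: algebra_simps)
    hence "norm (sigma_term n / (1 - x * q ^ n) - sigma_term n) =
        norm (sigma_term n) * norm (x * q ^ n) / norm (1 - x * q ^ n)"
      by (simp add: norm_mult norm_divide)
    also have "\<dots> \<le> norm (sigma_term n) * norm x / (1 / 2)"
      using d norm_orbit_le[of x n] by (intro frac_le mult_left_mono) auto
    finally show "norm (sigma_term n / (1 - x * q ^ n) - sigma_term n) \<le> t n"
      by (simp add: t_def mult_ac)
  qed
  finally show "norm (partial_fraction_series x - partial_fraction_series 0) \<le>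
      norm x * (2 * (\<Sum>n. norm (sigma_term n)))"
    by (simp add: t_def suminf_mult summable_sigma_term summable_mult)
qed simp

section \<open>The double series\<close>

definition double_term :: "complex \<Rightarrow> nat \<times> nat \<Rightarrow> complex" where
  "double_term z = (\<lambda>(m, n).
    binomial_coeff m * z ^ m * (euler_coeff n * z ^ n) * (z / (1 - q ^ Suc (m + n))))"

definition double_series :: "complex \<Rightarrow> complex" where
  "double_series z = (\<Sum>\<^sub>\<infinity>k. double_term z k)"

text \<open>
  One estimate with two uses: \<open>y = x\<close> gives absolute convergence, and a fixed \<open>y\<close> bounds the double
  series by a multiple of \<open>norm x\<close> near 0.
\<close>
lemma norm_double_term_le:
  assumes "norm x \<le> norm y"
  shows "norm (double_term x (m, n)) \<le>
    norm x / (1 - norm q) * norm (binomial_coeff m * y ^ m * (euler_coeff n * y ^ n))"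
proof -
  have 1: "norm (binomial_coeff m * x ^ m * (euler_coeff n * x ^ n)) \<le>
      norm (binomial_coeff m * y ^ m * (euler_coeff n * y ^ n))"
    unfolding norm_mult norm_power
    by (intro mult_mono mult_nonneg_nonneg power_mono assms order_refl) auto
  have 2: "norm x / norm (1 - q ^ Suc (m + n)) \<le> norm x / (1 - norm q)"
    using norm_orbit_denom[of q "m + n"] q power_Suc_ne(1)[OF q, of "m + n"]
    by (intro divide_left_mono mult_pos_pos) auto
  have "norm (double_term x (m, n)) =
      norm x / norm (1 - q ^ Suc (m + n)) * norm (binomial_coeff m * x ^ m * (euler_coeff n * x ^ n))"
    by (simp add: double_term_def norm_mult norm_divide)
  also have "\<dots> \<le> norm x / (1 - norm q) * norm (binomial_coeff m * y ^ m * (euler_coeff n * y ^ n))"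
    using q by (intro mult_mono 1 2) auto
  finally show ?thesis .
qed

lemma summable_norm_double_term:
  assumes "norm z < 1"
  shows "(\<lambda>k. norm (double_term z k)) summable_on UNIV"
proof (rule Infinite_Sum.abs_summable_on_comparison_test')
  show "(\<lambda>k. norm z / (1 - norm q) *
      (case k of (m, n) \<Rightarrow> norm (binomial_coeff m * z ^ m * (euler_coeff n * z ^ n)))) summable_on UNIV"
    by (intro summable_on_cmult_right summable_on_norm_product
        summable_binomial_series summable_euler_series assms)
  fix k :: "nat \<times> nat"
  show "norm (double_term z k) \<le> norm z / (1 - norm q) *
      (case k of (m, n) \<Rightarrow> norm (binomial_coeff m * z ^ m * (euler_coeff n * z ^ n)))"
    using norm_double_term_le[of z z] by (cases k) simp
qed

lemma isCont_double_series: "isCont double_series 0"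
proof (rule isCont_0_if_linear_bound)
  fix x :: complex assume x: "norm x < 1 / 2"
  define T where "T = (\<lambda>(m, n). norm (binomial_coeff m * (1 / 2) ^ m * (euler_coeff n * (1 / 2) ^ n)))"
  have T: "T summable_on UNIV"
    unfolding T_def by (intro summable_on_norm_product
        summable_binomial_series summable_euler_series) auto
  have "norm (double_series x) \<le> norm x / (1 - norm q) * infsum T UNIV"
    unfolding double_series_def
  proof (rule norm_infsum_le)
    show "(double_term x has_sum infsum (double_term x) UNIV) UNIV"
      by (rule has_sum_infsum[OF abs_summable_summable[OF summable_norm_double_term]]) (use x in simp)
    show "((\<lambda>k. norm x / (1 - norm q) * T k) has_sum (norm x / (1 - norm q) * infsum T UNIV)) UNIV"
      by (intro has_sum_cmult_right has_sum_infsum T)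
    show "norm (double_term x k) \<le> norm x / (1 - norm q) * T k" for k
    proof -
      have "norm x \<le> norm (1 / 2 :: complex)" using x by simp
      from norm_double_term_le[OF this] show ?thesis
        unfolding T_def by (cases k) (simp only: prod.case)
    qed
  qed
  moreover have "double_series 0 = 0"
    by (simp add: double_series_def double_term_def case_prod_unfold)
  ultimately show "norm (double_series x - double_series 0) \<le> norm x * (infsum T UNIV / (1 - norm q))"
    by simp
qed simp

text \<open>
  The factor \<open>1 - q\<^bsup>m+n+1\<^esup>\<close> produced by the difference cancels the only part of the term that couples
  \<open>m\<close> and \<open>n\<close>.
\<close>
lemma double_series_functional_eq:
  assumes z: "norm z < 1"
  shows "double_series z - double_series (z * q) = z * binomial_series z * euler_series z"
proof -
  have zq: "norm (z * q) < 1" using norm_orbit_le[of z 1] z by simp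
  have s: "double_term z summable_on UNIV" "double_term (z * q) summable_on UNIV"
    by (rule abs_summable_summable[OF summable_norm_double_term]; fact)+
  have step: "double_term z (m, n) - double_term (z * q) (m, n) =
      z * (binomial_coeff m * z ^ m * (euler_coeff n * z ^ n))" for m n
  proof -
    define a where "a = binomial_coeff m * z ^ m * (euler_coeff n * z ^ n)"
    have "double_term (z * q) (m, n) = a * q ^ Suc (m + n) * (z / (1 - q ^ Suc (m + n)))"
      by (simp add: double_term_def a_def power_mult_distrib power_add mult_ac)
    moreover have "double_term z (m, n) = a * (z / (1 - q ^ Suc (m + n)))"
      by (simp add: double_term_def a_def)
    ultimately have "double_term z (m, n) - double_term (z * q) (m, n) =
        z * a * ((1 - q ^ Suc (m + n)) / (1 - q ^ Suc (m + n)))"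
      by (simp only: divide_inverse) (simp only: algebra_simps mult_1_left)
    thus ?thesis using power_Suc_ne(1)[OF q, of "m + n"] by (simp add: a_def)
  qed
  have "double_series z - double_series (z * q) =
      (\<Sum>\<^sub>\<infinity>k. double_term z k - double_term (z * q) k)"
    using infsum_add[OF s(1) summable_on_uminus[THEN iffD2, OF s(2)]]
    by (simp add: double_series_def infsum_uminus)
  also have "\<dots> = (\<Sum>\<^sub>\<infinity>k.
      z * (case k of (m, n) \<Rightarrow> binomial_coeff m * z ^ m * (euler_coeff n * z ^ n)))"
    by (intro infsum_cong) (auto simp: step)
  also have "\<dots> = z * binomial_series z * euler_series z"
    using infsum_product[OF summable_binomial_series[OF z] summable_euler_series[OF z]]
    by (simp add: infsum_cmult_right' binomial_series_def euler_series_def)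
  finally show ?thesis .
qed

section \<open>Invariance of the expansion\<close>

definition sigma_expansion :: "complex \<Rightarrow> complex" where
  "sigma_expansion z = (1 + z) * product_series z * partial_fraction_series z - 2 * double_series z"

text \<open>
  The infinite product and the deformed series change by \<open>product_series z \<cdot> 2 z / (1 - z)\<close>. By
  definition of \<open>product_series\<close> the denominator cancels, leaving twice the change of the double series.
\<close>
lemma sigma_expansion_functional_eq:
  assumes z: "norm z < 1"
  shows "sigma_expansion z = sigma_expansion (z * q)"
proof -
  have product_shift: "product_series z = (1 + z * q) * product_series (z * q)"
    using product_series_functional_eq[OF z] by (simp add: mult_ac)
  have ne: "1 - z \<noteq> 0" using z by auto
  have "(1 + z) * product_series z * partial_fraction_series z -
      (1 + z * q) * product_series (z * q) * partial_fraction_series (z * q) =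
      product_series z * ((1 + z) * partial_fraction_series z - partial_fraction_series (z * q))"
    unfolding product_shift by (simp add: algebra_simps)
  also have "\<dots> = 2 * (z * binomial_series z * euler_series z)"
    unfolding partial_fraction_series_functional_eq[OF z] using ne
    by (simp add: product_series_def)
  also have "\<dots> = 2 * (double_series z - double_series (z * q))"
    by (simp add: double_series_functional_eq[OF z])
  finally show ?thesis by (simp add: sigma_expansion_def algebra_simps)
qed

lemma sigma_expansion_eq_sigma:
  assumes "norm z < 1"
  shows "sigma_expansion z = ramanujan_sigma q"
proof -
  have "sigma_expansion (z * q ^ n) = sigma_expansion z" for n
  proof (induction n)
    case (Suc n)
    thus ?case using sigma_expansion_functional_eq[of "z * q ^ n"] norm_orbit_le[of z n] assms
      by (simp add: mult_ac)
  qed simp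
  moreover have "isCont sigma_expansion 0"
    unfolding sigma_expansion_def[abs_def]
    by (intro continuous_intros isCont_product_series
        isCont_partial_fraction_series isCont_double_series)
  from tendsto_orbit[OF q this, of z] have "(\<lambda>n. sigma_expansion (z * q ^ n)) \<longlonglongrightarrow> sigma_expansion 0" .
  ultimately have "sigma_expansion z = sigma_expansion 0" by (simp add: LIMSEQ_const_iff)
  also have "sigma_expansion 0 = ramanujan_sigma q"
    by (simp add: sigma_expansion_def product_series_0 partial_fraction_series_0
        double_series_def double_term_def case_prod_unfold)
  finally show ?thesis .
qed

end

theorem theorem1p1:
  fixes q c :: complex
  assumes "norm q < 1" and "norm c < 1"
  shows "ramanujan_sigma q =
    qpoch_inf (- c) q *
      (\<Sum>n. q ^ (n * (n + 1) div 2) / (qpoch (- q) q n * (1 - c * q ^ n)))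
    - 2 * (\<Sum>\<^sub>\<infinity>(m, n)\<in>(UNIV :: (nat \<times> nat) set).
        qpoch (- q) q m / (qpoch q q m * qpoch q q n) *
        ((- 1) ^ n * q ^ (n * (n + 1) div 2) * c ^ (m + n + 1) / (1 - q ^ (n + m + 1))))"
proof -
  have "double_series q c = (\<Sum>\<^sub>\<infinity>(m, n)\<in>(UNIV :: (nat \<times> nat) set).
        qpoch (- q) q m / (qpoch q q m * qpoch q q n) *
        ((- 1) ^ n * q ^ (n * (n + 1) div 2) * c ^ (m + n + 1) / (1 - q ^ (n + m + 1))))"
    unfolding double_series_def[OF assms(1)]
    by (intro infsum_cong)
       (auto simp: double_term_def[OF assms(1)] binomial_coeff_def[OF assms(1)]
          euler_coeff_def[OF assms(1)] power_add add_ac mult_ac)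
  moreover have "partial_fraction_series q c =
      (\<Sum>n. q ^ (n * (n + 1) div 2) / (qpoch (- q) q n * (1 - c * q ^ n)))"
    by (simp add: partial_fraction_series_def[OF assms(1)] sigma_term_def[OF assms(1)])
  ultimately show ?thesis
    using sigma_expansion_eq_sigma[OF assms] qpoch_inf_eq_product_series[OF assms]
    by (simp add: sigma_expansion_def[OF assms(1)])
qed

end
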